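(* Let $f:[0,\infty)\to[0,\infty)$, $K>0$, $M\ge1$ and $c$ satisfy Assumptions A and B, and let $\{\xi_n\}$ satisfy Assumption N with $\nu=1$ (all stated in the context). Let $\alpha\in\left(1-\frac1M,1\right)$ and $\gamma=\max\{\alpha,1-\alpha\}$. For any $\varepsilon_1>0$ there exists $l>0$ satisfying $$l<(1-\gamma)(K-c)$$ such that any solution $\{x_n\}_{n\in\mathbb{N}_0}$ of $$x_{n+1}=\max\left\{f(x_n)-\alpha(f(x_n)-x_n)+l\xi_{n+1},\,0\right\},\qquad n\in\mathbb{N}_0,$$ with $x_0>0$ satisfies $$\mathbb P\left[\text{there exists }\mathcal N<\infty\text{ such that }x_n\in\left[\max\{K-\varepsilon_1,0\},\ K+\varepsilon_1\right]\text{ for all }n\ge\mathcal N\right]=1.$$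
   Context: $\mathbb{N}_0=\{0,1,2,\dots\}$. Assumption A: $f:[0,\infty)\to[0,\infty)$ is a continuous function, $f(x)>0$ for $x>0$, $f(x)>x$ for $x\in(0,K)$, $f(x)<x$ for $x>K$, and $M\ge1$ is a constant such that $|f(x)-K|\le M|x-K|$ for all $x\ge 0$. (Hence $K>0$ is the unique positive fixed point of $f$.) Assumption B: there is a point $c\in[0,K)$ such that $f$ is strictly decreasing on $[c,\infty)$. Probabilistic setting: $(\Omega,\mathcal F,\{\mathcal F_n\},\mathbb P)$ is a complete filtered probability space whose filtration is the one generated by the sequence $\{\xi_n\}$, and $x_0$ is a deterministic initial value. The integer $\mathcal N$ may depend on $\omega\in\Omega$. Assumption N (with parameter $\nu\ge1$): $\{\xi_n\}$ is a sequence of independent identically distributed continuous random variables with common density function $\phi$ whose support is the interval $[-1,\nu]$; $\xi_n(\omega)\in[-1,\nu]$ for all $n$ and all $\omega\in\Omega$, and every nondegenerate subinterval of $[-1,\nu]$ has positive probability under the law of $\xi_n$. *)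

theory Defs
  imports "HOL-Probability.Probability"
begin

text \<open>
  Functions on \<open>[0,\<infinity>)\<close> are total functions on the reals that are only constrained on
  \<open>{0..}\<close>; values at negative arguments are irrelevant throughout.
\<close>

definition assumption_A :: "(real \<Rightarrow> real) \<Rightarrow> real \<Rightarrow> real \<Rightarrow> bool" where
  "assumption_A f K M \<longleftrightarrow>
     f \<in> {0..} \<rightarrow> {0..} \<and> continuous_on {0..} f \<and> K > 0 \<and>
     (\<forall>x>0. f x > 0) \<and> (\<forall>x\<in>{0<..<K}. f x > x) \<and> (\<forall>x>K. f x < x) \<and>
     M \<ge> 1 \<and> (\<forall>x\<ge>0. \<bar>f x - K\<bar> \<le> M * \<bar>x - K\<bar>)"

definition assumption_B :: "(real \<Rightarrow> real) \<Rightarrow> real \<Rightarrow> real \<Rightarrow> bool" where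
  "assumption_B f K c \<longleftrightarrow> c \<in> {0..<K} \<and> strict_antimono_on {c..} f"

text \<open>
  The noise is indexed by \<open>n \<ge> 1\<close>, since the recurrence only involves \<open>\<xi> (Suc n)\<close>;
  \<open>\<xi> 0\<close> is unconstrained.
\<close>

definition natural_filtration :: "'a measure \<Rightarrow> (nat \<Rightarrow> 'a \<Rightarrow> real) \<Rightarrow> nat \<Rightarrow> 'a measure" where
  "natural_filtration P \<xi> n =
     sigma (space P) {\<xi> i -` A \<inter> space P | i A. i \<in> {1..n} \<and> A \<in> sets borel}"

locale complete_filtered_prob_space =
  prob_space P + complete_measure P + filtration "space P" F
  for P :: "'a measure" and F :: "nat \<Rightarrow> 'a measure" +
  assumes sets_F_subset: "sets (F n) \<subseteq> sets P"

text \<open>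
  A common Lebesgue density makes the variables continuous and identically distributed. The
  support of the density is the closure of the set where it does not vanish. This alone does not
  make subintervals of \<open>{-1..\<nu>}\<close> charged, because the density may be changed on null
  sets; the last conjunct does.
\<close>

definition assumption_N ::
  "'a measure \<Rightarrow> (nat \<Rightarrow> 'a \<Rightarrow> real) \<Rightarrow> (real \<Rightarrow> real) \<Rightarrow> real \<Rightarrow> bool" where
  "assumption_N P \<xi> \<phi> \<nu> \<longleftrightarrow>
     \<nu> \<ge> 1 \<and>
     prob_space.indep_vars P (\<lambda>_. borel) \<xi> {1..} \<and>
     (\<forall>y. \<phi> y \<ge> 0) \<and>
     (\<forall>n\<ge>1. distributed P lborel (\<xi> n) (\<lambda>y. ennreal (\<phi> y))) \<and>
     closure {y. \<phi> y \<noteq> 0} = {-1..\<nu>} \<and>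
     (\<forall>n\<ge>1. \<forall>\<omega>\<in>space P. \<xi> n \<omega> \<in> {-1..\<nu>}) \<and>
     (\<forall>n\<ge>1. \<forall>I. is_interval I \<and> I \<subseteq> {-1..\<nu>} \<and> (\<exists>a\<in>I. \<exists>b\<in>I. a < b) \<longrightarrow>
        measure (distr P borel (\<xi> n)) I > 0)"

definition is_solution ::
  "'a measure \<Rightarrow> (real \<Rightarrow> real) \<Rightarrow> real \<Rightarrow> real \<Rightarrow> (nat \<Rightarrow> 'a \<Rightarrow> real) \<Rightarrow> real \<Rightarrow> (nat \<Rightarrow> 'a \<Rightarrow> real) \<Rightarrow> bool"
where
  "is_solution P f \<alpha> l \<xi> x0 x \<longleftrightarrow>
     (\<forall>\<omega>\<in>space P. x 0 \<omega> = x0 \<and>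
        (\<forall>n. x (Suc n) \<omega> =
           max (f (x n \<omega>) - \<alpha> * (f (x n \<omega>) - x n \<omega>) + l * \<xi> (Suc n) \<omega>) 0))"

end

theory Submission
  imports Defs
begin

text \<open>
  Write \<open>g x = (1 - \<alpha>) * f x + \<alpha> * x\<close>, \<open>d = K - c\<close> and \<open>q = max \<alpha> ((1 - \<alpha>) * M)\<close>. The lower bound on
  \<open>\<alpha>\<close> says exactly that \<open>(1 - \<alpha>) * M < 1\<close>; as also \<open>\<alpha> < 1\<close>, it follows that \<open>q < 1\<close>. Whenever \<open>x\<close> and \<open>f x\<close> lie on different
  sides of \<open>K\<close>, the deviations from \<open>K\<close> of the two terms of \<open>g x\<close> have opposite signs, so \<open>g\<close>
  contracts the distance to \<open>K\<close> by the factor \<open>q\<close>; this covers every \<open>x \<ge> c\<close>. In the remaining case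
  \<open>x < c\<close> and \<open>f x < K\<close>, and then \<open>x \<le> g x \<le> K\<close>: the distance to \<open>K\<close> does not grow, but it need not
  shrink at a uniform rate, since \<open>0\<close> may be a second fixed point (lemma \<open>control_dichotomy\<close>).

  Noise of small amplitude \<open>l\<close> therefore has the following effect on \<open>V = \<bar>x - K\<bar>\<close>. The set
  \<open>V \<le> d\<close> is invariant, and inside it \<open>V\<close> falls geometrically to the level \<open>l / (1 - q)\<close>, which is
  below \<open>\<epsilon>\<^sub>1\<close> if \<open>l\<close> is small. Outside it, \<open>V\<close> stays bounded, and each noise value of at least \<open>1/2\<close>
  lowers \<open>V\<close> by at least \<open>l/2\<close> or else to at most \<open>d\<close>: the contraction does so where it acts, and the noise itself pushes the
  state away from \<open>0\<close> where it does not. Hence a run of sufficiently many consecutive noise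
  values of at least \<open>1/2\<close>, wherever it occurs, brings the solution into the invariant set for good
  (lemma \<open>captured\<close>). As the initial value is deterministic, so is the required length of the run,
  and independent variables almost surely have a run of any prescribed length
  (lemma \<open>AE_exists_run\<close>).
\<close>

section \<open>Runs in independent sequences\<close>

text \<open>
  Cut the indices into consecutive blocks of length \<open>J\<close>. The blocks are independent, and
  each is a run with probability at least \<open>p ^ J\<close>; so none of the first \<open>m\<close> blocks is a run with
  probability at most \<open>(1 - p ^ J) ^ m\<close>, which tends to \<open>0\<close>.
\<close>

lemma (in prob_space) AE_exists_run:
  fixes X :: "nat \<Rightarrow> 'a \<Rightarrow> 'b"
  assumes ind: "indep_vars (\<lambda>_. N) X {1..}"
    and S: "S \<in> sets N"
    and p: "0 < p" "\<And>n. n \<ge> 1 \<Longrightarrow> p \<le> prob (X n -` S \<inter> space M)"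
  shows "AE \<omega> in M. \<exists>n. \<forall>i\<in>{n<..n+J}. X i \<omega> \<in> S"
proof (cases "J = 0")
  case True
  then show ?thesis by simp
next
  case False
  define b where "b k = {k*J<..k*J+J}" for k
  have b_sub: "b k \<subseteq> {1..}" for k
    by (auto simp: b_def)
  have b_disj: "disjoint_family_on b UNIV"
  proof -
    have "k = k'" if "i \<in> b k" "i \<in> b k'" for i k k'
    proof -
      have "(i - 1) div J = k" if "i \<in> b k" for k
      proof -
        have "k * J \<le> i - 1" "i - 1 < k * J + J"
          using that by (auto simp: b_def)
        then show ?thesis
          by (intro div_nat_eqI) (auto simp: algebra_simps)
      qed
      with that show ?thesis by blast
    qed
    then show ?thesis
      by (auto simp: disjoint_family_on_def)
  qed
  have b_fin: "finite (b k)" "b k \<noteq> {}" and b_card: "card (b k) = J" for k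
    using False by (auto simp: b_def)
  define Y where "Y k \<omega> = restrict (\<lambda>i. X i \<omega>) (b k)" for k \<omega>
  have indY: "indep_vars (\<lambda>k. PiM (b k) (\<lambda>_. N)) Y UNIV"
    unfolding Y_def using indep_vars_restrict[OF ind b_sub b_disj] by simp
  define R where "R k = PiE (b k) (\<lambda>_. S)" for k
  have R: "R k \<in> sets (PiM (b k) (\<lambda>_. N))" for k
    unfolding R_def using S b_fin by (intro sets_PiM_I_finite) auto
  have Y_meas: "Y k \<in> measurable M (PiM (b k) (\<lambda>_. N))" for k
    using indY by (auto simp: indep_vars_def)
  have Y_in: "\<omega> \<in> space M \<Longrightarrow> Y k \<omega> \<in> R k \<longleftrightarrow> (\<forall>i\<in>b k. X i \<omega> \<in> S)" for k \<omega>
    by (auto simp: Y_def R_def PiE_iff)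
  define D where "D k = space (PiM (b k) (\<lambda>_. N)) - R k" for k
  have D: "D k \<in> sets (PiM (b k) (\<lambda>_. N))" for k
    unfolding D_def using R by auto
  have run_prob: "p ^ J \<le> prob (Y k -` R k \<inter> space M)" for k
  proof -
    have "p ^ J = (\<Prod>i\<in>b k. p)"
      by (simp add: b_card)
    also have "\<dots> \<le> (\<Prod>i\<in>b k. prob (X i -` S \<inter> space M))"
      using p b_sub by (intro prod_mono) (auto intro: less_imp_le)
    also have "\<dots> = prob (\<Inter>i\<in>b k. X i -` S \<inter> space M)"
      using indep_varsD[OF ind b_fin(2) b_fin(1) b_sub, where A="\<lambda>_. S"] S by simp
    also have "(\<Inter>i\<in>b k. X i -` S \<inter> space M) = Y k -` R k \<inter> space M"
      using b_fin(2)[of k] Y_in by auto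
    finally show ?thesis .
  qed
  have no_run: "prob (Y k -` D k \<inter> space M) \<le> 1 - p ^ J" for k
  proof -
    have "Y k -` D k \<inter> space M = space M - (Y k -` R k \<inter> space M)"
      using Y_meas[of k] by (auto simp: D_def dest: measurable_space)
    then show ?thesis
      using run_prob[of k] prob_compl[OF measurable_sets[OF Y_meas R]] by simp
  qed
  define Z where "Z = (\<Inter>k. Y k -` D k \<inter> space M)"
  have Z: "Z \<in> events"
    unfolding Z_def using measurable_sets[OF Y_meas D] by (intro sets.countable_INT) auto
  have Z_le: "prob Z \<le> (1 - p ^ J) ^ Suc m" for m
  proof -
    have "(\<Inter>k\<in>{..m}. Y k -` D k \<inter> space M) \<in> events"
      using measurable_sets[OF Y_meas D] by (intro sets.finite_INT) auto
    then have "prob Z \<le> prob (\<Inter>k\<in>{..m}. Y k -` D k \<inter> space M)"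
      by (rule finite_measure_mono[rotated]) (auto simp: Z_def)
    also have "\<dots> = (\<Prod>k\<in>{..m}. prob (Y k -` D k \<inter> space M))"
      using indep_varsD[OF indY, where J="{..m}" and A=D] D by auto
    also have "\<dots> \<le> (\<Prod>k\<in>{..m}. 1 - p ^ J)"
      using no_run by (intro prod_mono) auto
    finally show ?thesis by simp
  qed
  have "0 \<le> 1 - p ^ J"
    using no_run[of 0] measure_nonneg order_trans by blast
  then have "(\<lambda>m. (1 - p ^ J) ^ Suc m) \<longlonglongrightarrow> 0"
    using p(1) by (intro LIMSEQ_Suc LIMSEQ_realpow_zero) auto
  then have "prob Z \<le> 0"
    using Z_le by (intro LIMSEQ_le_const) auto
  then have "prob Z = 0"
    using measure_nonneg[of M Z] by linarith
  then have "AE \<omega> in M. \<omega> \<notin> Z"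
    using prob_eq_0[OF Z] by simp
  then show ?thesis
  proof (rule AE_mp, intro AE_I2 impI)
    fix \<omega> assume \<omega>: "\<omega> \<in> space M" "\<omega> \<notin> Z"
    then obtain k where "Y k \<omega> \<in> R k"
      using Y_meas by (fastforce simp: Z_def D_def dest: measurable_space)
    then show "\<exists>n. \<forall>i\<in>{n<..n+J}. X i \<omega> \<in> S"
      using Y_in \<omega>(1) by (auto simp: b_def)
  qed
qed

section \<open>The controlled map without noise\<close>

text \<open>
  If \<open>u\<close> and \<open>v\<close> have opposite signs, so do the two parts of \<open>(1 - \<alpha>) * u + \<alpha> * v\<close>, and the modulus of
  a sum of such parts is at most the larger of their moduli, not merely their sum.
\<close>

lemma opposite_sign_average_bound:
  fixes u v \<alpha> M :: real
  assumes "0 \<le> \<alpha>" "\<alpha> \<le> 1" "u * v \<le> 0" "\<bar>u\<bar> \<le> M * \<bar>v\<bar>"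
  shows "\<bar>(1 - \<alpha>) * u + \<alpha> * v\<bar> \<le> max \<alpha> ((1 - \<alpha>) * M) * \<bar>v\<bar>"
proof -
  let ?a = "(1 - \<alpha>) * u" and ?b = "\<alpha> * v" and ?q = "max \<alpha> ((1 - \<alpha>) * M)"
  have "?a * ?b = ((1 - \<alpha>) * \<alpha>) * (u * v)"
    by (simp add: algebra_simps)
  also have "\<dots> \<le> 0"
    using assms by (simp add: mult_nonneg_nonpos)
  finally have "\<bar>?a + ?b\<bar> \<le> max \<bar>?a\<bar> \<bar>?b\<bar>"
    using iffD1[OF mult_le_0_iff] by fastforce
  moreover have "\<bar>?a\<bar> \<le> ?q * \<bar>v\<bar>"
  proof -
    have "\<bar>?a\<bar> = (1 - \<alpha>) * \<bar>u\<bar>"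
      using assms by (simp add: abs_mult)
    also have "\<dots> \<le> ((1 - \<alpha>) * M) * \<bar>v\<bar>"
      using mult_left_mono[OF assms(4), of "1 - \<alpha>"] assms(2) by (simp add: mult.assoc)
    also have "\<dots> \<le> ?q * \<bar>v\<bar>"
      by (intro mult_right_mono) auto
    finally show ?thesis .
  qed
  moreover have "\<bar>?b\<bar> \<le> ?q * \<bar>v\<bar>"
    using assms(1) by (simp add: abs_mult mult_right_mono)
  ultimately show ?thesis by linarith
qed

text \<open>
  Beyond \<open>c\<close> the monotonicity of \<open>f\<close> puts \<open>x\<close> and \<open>f x\<close> on different sides of \<open>K = f K\<close>. Below \<open>c\<close>
  this may fail, and then both \<open>x\<close> and \<open>f x\<close> lie below \<open>K\<close>.
\<close>

lemma control_dichotomy: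
  assumes A: "assumption_A f K M" and B: "assumption_B f K c"
    and \<alpha>: "0 \<le> \<alpha>" "\<alpha> \<le> 1" and x: "0 \<le> x"
  defines "g \<equiv> \<lambda>x. (1 - \<alpha>) * f x + \<alpha> * x"
  shows "\<bar>g x - K\<bar> \<le> max \<alpha> ((1 - \<alpha>) * M) * \<bar>x - K\<bar> \<or> x < c \<and> x \<le> g x \<and> g x \<le> K"
proof -
  have K: "0 < K" and M: "\<And>x. 0 \<le> x \<Longrightarrow> \<bar>f x - K\<bar> \<le> M * \<bar>x - K\<bar>"
    and up: "\<And>x. 0 < x \<Longrightarrow> x < K \<Longrightarrow> x < f x" and f_nonneg: "0 \<le> f 0"
    using A by (auto simp: assumption_A_def Pi_iff)
  have c: "0 \<le> c" "c < K" and anti: "\<And>x y. c \<le> x \<Longrightarrow> x < y \<Longrightarrow> f y < f x"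
    using B by (auto simp: assumption_B_def monotone_on_def)
  have fK: "f K = K"
    using M[of K] K by simp
  have diff: "g x - K = (1 - \<alpha>) * (f x - K) + \<alpha> * (x - K)"
    by (simp add: g_def algebra_simps)
  show ?thesis
  proof (cases "x < c \<and> f x < K")
    case True
    have "x \<le> f x"
      using up[of x] x f_nonneg True c by (cases "x = 0") auto
    then have "(1 - \<alpha>) * x \<le> (1 - \<alpha>) * f x" "(1 - \<alpha>) * f x \<le> (1 - \<alpha>) * K" "\<alpha> * x \<le> \<alpha> * K"
      using True c \<alpha> by (auto intro!: mult_left_mono)
    then have "x \<le> g x \<and> g x \<le> K"
      unfolding g_def by (simp add: algebra_simps)
    with True show ?thesis by blast
  next
    case False
    have "(f x - K) * (x - K) \<le> 0"
    proof (cases "x < c")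
      case True
      then show ?thesis
        using False c by (intro mult_nonneg_nonpos) auto
    next
      case False
      then show ?thesis
        using anti[of x K] anti[of K x] fK c
        by (cases x K rule: linorder_cases) (auto simp: mult_le_0_iff)
    qed
    from opposite_sign_average_bound[OF \<alpha> this M[OF x]] show ?thesis
      unfolding diff by blast
  qed
qed

section \<open>Noisy orbits\<close>

text \<open>
  An orbit of a map with the dichotomy above under noise \<open>e\<close> of amplitude \<open>l\<close>. The bound on \<open>l\<close>
  makes the noise at most half of what the contraction gains at distance \<open>K - c\<close> from \<open>K\<close>, which
  gives both the invariance of that neighbourhood and the strict progress outside it.
\<close>

locale noisy_orbit =
  fixes g :: "real \<Rightarrow> real" and K c q l :: real and e x :: "nat \<Rightarrow> real"
  assumes c: "0 \<le> c" "c < K"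
    and q: "0 \<le> q" "q < 1"
    and l: "0 < l" "2 * l \<le> (1 - q) * (K - c)"
    and dichotomy: "\<And>y. 0 \<le> y \<Longrightarrow> \<bar>g y - K\<bar> \<le> q * \<bar>y - K\<bar> \<or> y < c \<and> y \<le> g y \<and> g y \<le> K"
    and noise: "\<And>n. \<bar>e (Suc n)\<bar> \<le> 1"
    and start: "0 \<le> x 0"
    and step: "\<And>n. x (Suc n) = max (g (x n) + l * e (Suc n)) 0"
begin

lemma nonneg: "0 \<le> x n"
  using start step by (cases n) auto

lemma noise_bound: "\<bar>l * e (Suc n)\<bar> \<le> l"
  using noise[of n] l(1) by (simp add: abs_mult mult_left_le)

text \<open>Truncation at \<open>0\<close> moves negative values towards \<open>K\<close>, so it can be ignored in upper bounds.\<close>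

lemma truncation: "\<bar>x (Suc n) - K\<bar> \<le> \<bar>g (x n) + l * e (Suc n) - K\<bar>"
  using step[of n] c by (auto simp: max_def)

lemma near_contracts:
  assumes "\<bar>x n - K\<bar> \<le> K - c"
  shows "\<bar>x (Suc n) - K\<bar> \<le> q * \<bar>x n - K\<bar> + l"
  using dichotomy[OF nonneg, of n] truncation[of n] noise_bound[of n] assms by linarith

lemma near_invariant:
  assumes "\<bar>x n - K\<bar> \<le> K - c"
  shows "\<bar>x (Suc n) - K\<bar> \<le> K - c"
proof -
  have "q * \<bar>x n - K\<bar> \<le> q * (K - c)"
    using assms q by (intro mult_left_mono) auto
  then have "q * \<bar>x n - K\<bar> + l \<le> K - c"
    using l by (simp add: algebra_simps)
  with near_contracts[OF assms] show ?thesis by linarith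
qed

lemma contraction_gain:
  assumes "K - c \<le> \<bar>y - K\<bar>"
  shows "q * \<bar>y - K\<bar> + l \<le> \<bar>y - K\<bar> - l"
proof -
  have "(1 - q) * (K - c) \<le> (1 - q) * \<bar>y - K\<bar>"
    using assms q by (intro mult_left_mono) auto
  then show ?thesis
    using l(2) by (simp add: algebra_simps)
qed

lemma l_le: "l \<le> K - c"
proof -
  have "(1 - q) * (K - c) \<le> 1 * (K - c)"
    using q c by (intro mult_right_mono) auto
  with l(2) have "2 * l \<le> K - c" by simp
  with l(1) show ?thesis by simp
qed

text \<open>
  A downward push below \<open>c\<close> can increase the distance, but not beyond \<open>K\<close>, because states are
  nonnegative.
\<close>

lemma distance_bounded: "\<bar>x n - K\<bar> \<le> max K \<bar>x 0 - K\<bar>"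
proof (induction n)
  case (Suc n)
  show ?case
  proof (cases "\<bar>x n - K\<bar> \<le> K - c")
    case True
    then show ?thesis using near_invariant c by fastforce
  next
    case False
    from dichotomy[OF nonneg, of n] show ?thesis
    proof (elim disjE conjE)
      assume "\<bar>g (x n) - K\<bar> \<le> q * \<bar>x n - K\<bar>"
      then show ?thesis
        using contraction_gain[of "x n"] False truncation[of n] noise_bound[of n] l(1) Suc.IH
        by linarith
    next
      assume "g (x n) \<le> K"
      then have "x (Suc n) \<le> K + l"
        using step[of n] noise_bound[of n] c l(1) by auto
      then show ?thesis
        using nonneg[of "Suc n"] l_le c by auto
    qed
  qed
qed simp

lemma progress:
  assumes "1/2 \<le> e (Suc n)"
  shows "\<bar>x (Suc n) - K\<bar> \<le> max (K - c) (\<bar>x n - K\<bar> - l/2)"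
proof (cases "\<bar>x n - K\<bar> \<le> K - c")
  case True
  then show ?thesis using near_invariant[of n] by simp
next
  case False
  have push: "l/2 \<le> l * e (Suc n)"
    using mult_left_mono[OF assms, of l] l(1) by simp
  from dichotomy[OF nonneg, of n] show ?thesis
  proof (elim disjE conjE)
    assume "\<bar>g (x n) - K\<bar> \<le> q * \<bar>x n - K\<bar>"
    then show ?thesis
      using contraction_gain[of "x n"] False truncation[of n] noise_bound[of n] l(1) by linarith
  next
    assume *: "x n \<le> g (x n)" "g (x n) \<le> K"
    have "x n + l/2 \<le> g (x n) + l * e (Suc n)" "g (x n) + l * e (Suc n) \<le> K + l"
      using * push noise_bound[of n] by linarith+
    then show ?thesis
      using truncation[of n] l_le * by linarith
  qed
qed

lemma progress_along_run:
  assumes "\<And>i. i \<in> {n<..n+j} \<Longrightarrow> 1/2 \<le> e i"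
  shows "\<bar>x (n+j) - K\<bar> \<le> max (K - c) (max K \<bar>x 0 - K\<bar> - real j * (l/2))"
  using assms
proof (induction j)
  case 0
  then show ?case using distance_bounded[of n] by simp
next
  case (Suc j)
  have "\<bar>x (n+j) - K\<bar> \<le> max (K - c) (max K \<bar>x 0 - K\<bar> - real j * (l/2))"
    using Suc by simp
  moreover have "\<bar>x (Suc (n+j)) - K\<bar> \<le> max (K - c) (\<bar>x (n+j) - K\<bar> - l/2)"
    using Suc.prems by (intro progress) simp
  moreover have "real (Suc j) * (l/2) = real j * (l/2) + l/2"
    by (simp add: algebra_simps)
  ultimately show ?case
    using l(1) unfolding add_Suc_right by linarith
qed

text \<open>The constant \<open>l / (1 - q)\<close> is the fixed point of the recursion \<open>v \<mapsto> q * v + l\<close>.\<close>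

lemma geometric_decay:
  assumes "\<bar>x n - K\<bar> \<le> K - c"
  shows "\<bar>x (n+k) - K\<bar> \<le> K - c \<and> \<bar>x (n+k) - K\<bar> \<le> q ^ k * (K - c) + l / (1 - q)"
proof (induction k)
  case 0
  have "0 \<le> l / (1 - q)" using l q by simp
  then show ?case using assms by (auto intro: add_increasing2)
next
  case (Suc k)
  let ?v = "q ^ k * (K - c) + l / (1 - q)"
  have "\<bar>x (Suc (n+k)) - K\<bar> \<le> q * \<bar>x (n+k) - K\<bar> + l"
    using Suc.IH near_contracts by blast
  also have "\<dots> \<le> q * ?v + l"
    using Suc.IH q by (intro add_right_mono mult_left_mono) auto
  also have "\<dots> = q ^ Suc k * (K - c) + l / (1 - q)"
    using q by (simp add: field_simps)
  finally show ?case
    using near_invariant[of "n+k"] Suc.IH by simp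
qed

text \<open>
  The run must be long enough to use up the largest possible distance \<open>max K \<bar>x 0 - K\<bar>\<close> in steps of
  \<open>l/2\<close>; its position \<open>n\<close> does not matter. The factor \<open>2\<close> in the bound on \<open>l\<close> leaves \<open>\<epsilon>/2\<close> for the
  geometrically decaying part.
\<close>

lemma captured:
  assumes run: "\<And>i. i \<in> {n<..n+J} \<Longrightarrow> 1/2 \<le> e i"
    and J: "max K \<bar>x 0 - K\<bar> \<le> real J * (l/2)"
    and \<epsilon>: "0 < \<epsilon>" "2 * l \<le> (1 - q) * \<epsilon>"
  shows "\<exists>N. \<forall>m\<ge>N. \<bar>x m - K\<bar> \<le> \<epsilon>"
proof -
  have "\<bar>x (n+J) - K\<bar> \<le> K - c"
    using progress_along_run[OF run] J c by fastforce
  note decay = geometric_decay[OF this]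
  have "(\<lambda>k. q ^ k * (K - c)) \<longlonglongrightarrow> 0"
    using q by (intro tendsto_mult_left_zero LIMSEQ_realpow_zero) auto
  then have "\<forall>\<^sub>F k in sequentially. q ^ k * (K - c) < \<epsilon>/2"
    using \<epsilon>(1) by (intro order_tendstoD) auto
  then obtain k0 where k0: "\<And>k. k \<ge> k0 \<Longrightarrow> q ^ k * (K - c) < \<epsilon>/2"
    by (auto simp: eventually_sequentially)
  have level: "l / (1 - q) \<le> \<epsilon>/2"
    using \<epsilon>(2) q by (simp add: field_simps)
  have "\<bar>x m - K\<bar> \<le> \<epsilon>" if "m \<ge> n + J + k0" for m
  proof -
    define k where "k = m - (n + J)"
    then have m: "m = n + J + k" and "k0 \<le> k"
      using that by auto
    then show ?thesis
      using decay[of k] k0[of k] level unfolding m by linarith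
  qed
  then show ?thesis by blast
qed

end

section \<open>Stochastic stabilisation\<close>

theorem theorem4p2:
  fixes P :: "'a measure" and F :: "nat \<Rightarrow> 'a measure"
    and \<xi> :: "nat \<Rightarrow> 'a \<Rightarrow> real" and \<phi> :: "real \<Rightarrow> real"
    and f :: "real \<Rightarrow> real" and K M c \<alpha> \<gamma> \<epsilon>\<^sub>1 :: real
  assumes "complete_filtered_prob_space P F"
    and "F = natural_filtration P \<xi>"
    and "assumption_A f K M"
    and "assumption_B f K c"
    and "assumption_N P \<xi> \<phi> 1"
    and "\<alpha> \<in> {1 - 1 / M<..<1}"
    and "\<gamma> = max \<alpha> (1 - \<alpha>)"
    and "\<epsilon>\<^sub>1 > 0"
  shows "\<exists>l>0. l < (1 - \<gamma>) * (K - c) \<and>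
    (\<forall>x0>0. \<forall>x. is_solution P f \<alpha> l \<xi> x0 x \<longrightarrow>
       measure P {\<omega> \<in> space P. \<exists>N. \<forall>n\<ge>N. x n \<omega> \<in> {max (K - \<epsilon>\<^sub>1) 0..K + \<epsilon>\<^sub>1}} = 1)"
proof -
  interpret complete_filtered_prob_space P F by fact
  note A = assms(3) and B = assms(4) and N = assms(5)
  have K: "0 < K" and M: "1 \<le> M"
    using A by (auto simp: assumption_A_def)
  have c: "0 \<le> c" "c < K"
    using B by (auto simp: assumption_B_def)
  have "0 \<le> 1 - 1 / M"
    using M by simp
  then have \<alpha>: "0 < \<alpha>" "\<alpha> < 1"
    using assms(6) by auto
  have "(1 - \<alpha>) * M < 1"
    using assms(6) M by (simp add: field_simps)
  define q where "q = max \<alpha> ((1 - \<alpha>) * M)"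
  have q: "0 \<le> q" "q < 1"
    using \<alpha> \<open>(1 - \<alpha>) * M < 1\<close> by (auto simp: q_def)
  have \<gamma>: "\<gamma> < 1"
    using assms(7) \<alpha> by auto
  define l where "l = Min {(1 - \<gamma>) * (K - c), (1 - q) * (K - c), (1 - q) * \<epsilon>\<^sub>1} / 2"
  have pos: "0 < (1 - \<gamma>) * (K - c)" "0 < (1 - q) * (K - c)" "0 < (1 - q) * \<epsilon>\<^sub>1"
    using \<gamma> q c assms(8) by auto
  have l_bounds: "0 < l" "2 * l \<le> (1 - \<gamma>) * (K - c)" "2 * l \<le> (1 - q) * (K - c)" "2 * l \<le> (1 - q) * \<epsilon>\<^sub>1"
    using pos by (auto simp: l_def)
  define g where "g y = (1 - \<alpha>) * f y + \<alpha> * y" for y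

  have ind: "indep_vars (\<lambda>_. borel) \<xi> {1..}"
    and dens: "\<And>n. n \<ge> 1 \<Longrightarrow> distributed P lborel (\<xi> n) (\<lambda>y. ennreal (\<phi> y))"
    and bounds: "\<And>n \<omega>. n \<ge> 1 \<Longrightarrow> \<omega> \<in> space P \<Longrightarrow> \<bar>\<xi> n \<omega>\<bar> \<le> 1"
    using N by (auto simp: assumption_N_def abs_le_iff)
  have charged: "measure (distr P borel (\<xi> n)) I > 0"
    if "n \<ge> 1" "is_interval I" "I \<subseteq> {-1..1}" "a \<in> I" "b \<in> I" "a < b" for n I a b
    using N that unfolding assumption_N_def by blast
  have meas: "\<xi> n \<in> borel_measurable P" if "n \<ge> 1" for n
    using ind that by (auto simp: indep_vars_def)
  let ?S = "{1/2..1::real}"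
  define p where "p = measure (density lborel (\<lambda>y. ennreal (\<phi> y))) ?S"
  have p_eq: "prob (\<xi> n -` ?S \<inter> space P) = p" if "n \<ge> 1" for n
  proof -
    have "measure (distr P lborel (\<xi> n)) ?S = prob (\<xi> n -` ?S \<inter> space P)"
      using meas[OF that] by (intro measure_distr) auto
    then show ?thesis
      using distributed_distr_eq_density[OF dens[OF that]] by (simp add: p_def)
  qed
  have "0 < measure (distr P borel (\<xi> 1)) ?S"
    by (rule charged[of 1 _ "1/2" 1]) (auto simp: is_interval_cc)
  also have "\<dots> = prob (\<xi> 1 -` ?S \<inter> space P)"
    using meas[of 1] by (intro measure_distr) auto
  finally have "0 < p"
    using p_eq[of 1] by simp
  then have runs: "AE \<omega> in P. \<exists>n. \<forall>i\<in>{n<..n+J}. \<xi> i \<omega> \<in> ?S" for J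
    using AE_exists_run[OF ind, of ?S p] p_eq by simp

  have "measure P {\<omega> \<in> space P. \<exists>N. \<forall>n\<ge>N. x n \<omega> \<in> {max (K - \<epsilon>\<^sub>1) 0..K + \<epsilon>\<^sub>1}} = 1"
    if x0: "0 < x0" and sol: "is_solution P f \<alpha> l \<xi> x0 x" for x0 x
  proof -
    let ?G = "\<lambda>\<omega>. \<exists>N. \<forall>n\<ge>N. x n \<omega> \<in> {max (K - \<epsilon>\<^sub>1) 0..K + \<epsilon>\<^sub>1}"
    obtain J where J: "max K \<bar>x0 - K\<bar> \<le> real J * (l/2)"
      using reals_Archimedean3[of "l/2"] l_bounds(1) less_imp_le by (metis half_gt_zero)
    have G: "AE \<omega> in P. ?G \<omega>"
      using runs[of J]
    proof (rule AE_mp, intro AE_I2 impI)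
      fix \<omega> assume \<omega>: "\<omega> \<in> space P" and "\<exists>n. \<forall>i\<in>{n<..n+J}. \<xi> i \<omega> \<in> ?S"
      then obtain n where "\<forall>i\<in>{n<..n+J}. \<xi> i \<omega> \<in> ?S"
        by blast
      then have n: "1/2 \<le> \<xi> i \<omega>" if "i \<in> {n<..n+J}" for i
        using that by simp
      interpret noisy_orbit g K c q l "\<lambda>n. \<xi> n \<omega>" "\<lambda>n. x n \<omega>"
      proof
        fix y :: real assume "0 \<le> y"
        then show "\<bar>g y - K\<bar> \<le> q * \<bar>y - K\<bar> \<or> y < c \<and> y \<le> g y \<and> g y \<le> K"
          using control_dichotomy[OF A B _ _ \<open>0 \<le> y\<close>, of \<alpha>] \<alpha> by (simp add: g_def q_def)
      next
        fix n
        have "g (x n \<omega>) = f (x n \<omega>) - \<alpha> * (f (x n \<omega>) - x n \<omega>)"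
          by (simp add: g_def algebra_simps)
        then show "x (Suc n) \<omega> = max (g (x n \<omega>) + l * \<xi> (Suc n) \<omega>) 0"
          using sol \<omega> by (simp add: is_solution_def)
      qed (use c q l_bounds bounds \<omega> sol x0 in \<open>auto simp: is_solution_def\<close>)
      have "max K \<bar>x 0 \<omega> - K\<bar> \<le> real J * (l/2)"
        using J sol \<omega> by (simp add: is_solution_def)
      then have "\<exists>N. \<forall>m\<ge>N. \<bar>x m \<omega> - K\<bar> \<le> \<epsilon>\<^sub>1"
        by (intro captured[of n J] n assms(8) l_bounds(4))
      then obtain N where "\<forall>m\<ge>N. \<bar>x m \<omega> - K\<bar> \<le> \<epsilon>\<^sub>1" ..
      then have "x m \<omega> \<in> {max (K - \<epsilon>\<^sub>1) 0..K + \<epsilon>\<^sub>1}" if "m \<ge> N" for m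
        using that nonneg[of m] by (force simp: abs_le_iff)
      then show "?G \<omega>" by blast
    qed
    \<comment> \<open>Completeness makes the event measurable, being almost sure.\<close>
    have "{\<omega> \<in> space P. ?G \<omega>} \<in> events"
    proof (rule in_sets_AE)
      show "AE \<omega> in P. \<omega> \<in> space P \<longleftrightarrow> \<omega> \<in> {\<omega> \<in> space P. ?G \<omega>}"
        using G by (rule AE_mp) (rule AE_I2, blast)
    qed auto
    from prob_Collect_eq_1[OF this] G show ?thesis
      by (rule iffD2)
  qed
  moreover have "l < (1 - \<gamma>) * (K - c)"
    using l_bounds by linarith
  ultimately show ?thesis
    using l_bounds(1) by blast
qed

end
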